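(* Let $Q$ be a simply connected S-quad-graph, and let $c:Q\to\mathbb{C}$ be an orthogonal circle pattern in the plane: for white vertices $x\in Q$, $c(x)$ is the centre of the corresponding circle, and for black vertices $y\in Q$, $c(y)$ is the corresponding intersection point. The S-isothermic minimal surface $$F:\{x\in Q\mid x \text{ is labelled } s\}\to\mathbb{R}^3,\qquad F(x)=\text{the centre of the sphere corresponding to } x,$$ that corresponds to this circle pattern is given by the following formula. Let $x_1,x_2\in Q$ be two vertices, both labelled $s$, that correspond to touching circles of the pattern, and let $y\in Q$ be the black vertex between $x_1$ and $x_2$, which corresponds to the point of contact. The centres $F(x_1)$ and $F(x_2)$ of the corresponding touching spheres of $F$ satisfy $$F(x_2)-F(x_1)=\pm\operatorname{Re}\left(\frac{R(x_2)+R(x_1)}{1+|p|^2}\;\frac{\overline{c(x_2)}-\overline{c(x_1)}}{|c(x_2)-c(x_1)|}\begin{pmatrix}1-p^2\\ i(1+p^2)\\ 2p\end{pmatrix}\right),$$ where $p=c(y)$ and the radii $R(x_j)$ of the spheres are $$R(x_j)=\left|\frac{1+|c(x_j)|^2-|c(x_j)-p|^2}{2|c(x_j)-p|}\right|,\qquad j=1,2.$$ The sign on the right-hand side of the formula for $F(x_2)-F(x_1)$ depends on whether the two edges of the quad-graph connecting $x_1$ with $y$ and $y$ with $x_2$ are labelled $+$ or $-$.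
   Context: A quad-graph is a cell decomposition of an oriented two-dimensional manifold (possibly with boundary) all of whose faces are quadrilaterals. An S-quad-graph is a quad-graph $Q$ whose interior vertices have even degree, together with a bipartite colouring of the vertices into black and white (edges join black to white) such that interior black vertices have degree 4, and a labelling of the white vertices by $c$ ("circle") or $s$ ("sphere") such that each quadrilateral has one $c$-labelled and one $s$-labelled white vertex. Edge labels: since $Q$ is simply connected, its edges can be labelled $+$ and $-$ such that each quadrilateral has two opposite edges labelled $+$ and the other two opposite edges labelled $-$. The two edges joining a black vertex to its two $s$-labelled neighbours then have the same label. Orthogonal circle pattern: to each white vertex corresponds a circle in the plane and to each black vertex a point lying on the circles of its white neighbours. At the point of a black vertex, the circles of its two $s$-labelled neighbours touch (externally), the circles of its two $c$-labelled neighbours touch (externally), and the circles of an $s$-labelled and a $c$-labelled neighbour intersect orthogonally. The S-isothermic minimal surface corresponding to the pattern is obtained by projecting the pattern stereographically to the unit sphere $S^2$ and dualizing the corresponding Koebe polyhedron. Here stereographic projection is $\sigma(p)=\frac{1}{1+|p|^2}(2\operatorname{Re}p,\,2\operatorname{Im}p,\,|p|^2-1)$. The Koebe polyhedron is the surface formed by the spheres that intersect $S^2$ orthogonally along the projected circles of the $s$-labelled vertices, and by the projected circles of the $c$-labelled vertices; its polyhedral vertices are the centres of these spheres, and its edges connect the centres of touching spheres and are tangent to $S^2$ at the projected intersection points. It is regarded as a map $K$ on all vertices of $Q$ by sending black vertices to the projected intersection points and white vertices to the centres of their spheres or circles. The dual is the map $F$ defined, up to translation, by $\Delta F=\pm\Delta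 K/\|\Delta K\|^2$ along each edge of $Q$, where $\Delta$ denotes the difference of the values at neighbouring vertices and the sign is the edge label. It consists again of spheres and circles: for an $s$-labelled vertex $x$, $F(x)$ is the centre of the sphere corresponding to $x$, which passes through the points $F(y)$ for the black neighbours $y$ of $x$. *)

theory Defs
  imports "HOL-Analysis.Analysis"
begin

section \<open>Quad-graphs\<close>

definition surface_with_boundary :: "'m::topological_space set \<Rightarrow> bool" where
  "surface_with_boundary M \<longleftrightarrow>
     (\<forall>x\<in>M. \<exists>U W. openin (top_of_set M) U \<and> x \<in> U \<and>
        openin (top_of_set {z::complex. 0 \<le> Im z}) W \<and> U homeomorphic W)"

definition surface_interior :: "'m::topological_space set \<Rightarrow> 'm set" where
  "surface_interior M =
     {x \<in> M. \<exists>U W. openin (top_of_set M) U \<and> x \<in> U \<and> open (W :: complex set) \<and> U homeomorphic W}"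

text \<open>
  The model quadrilateral is the square with corners \<open>\<i>\<^sup>0, \<i>\<^sup>1, \<i>\<^sup>2, \<i>\<^sup>3\<close> in counterclockwise order;
  its side number \<open>i < 4\<close> runs from \<open>\<i> ^ i\<close> to \<open>\<i> ^ Suc i\<close>. A cell decomposition of a surface into
  quadrilaterals is given by its characteristic maps \<open>chart Q f\<close> from the square to the surface, one
  for each face \<open>f\<close>, and by the pairs \<open>((f, i), (g, j))\<close> of sides that are glued to each other.
\<close>

definition square :: "complex set" where
  "square = convex hull (range (\<lambda>i. \<i> ^ i))"

record ('f, 'm) cell_complex =
  surface :: "'m set"
  faces :: "'f set"
  glue :: "(('f \<times> nat) \<times> ('f \<times> nat)) set"
  chart :: "'f \<Rightarrow> complex \<Rightarrow> 'm"

text \<open>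
  Glued sides are identified with reversed direction, so that the counterclockwise orientations of
  the squares fit together to an orientation of the surface.
\<close>

definition side_identification ::
    "('f, 'm) cell_complex \<Rightarrow> (('f \<times> complex) \<times> ('f \<times> complex)) set" where
  "side_identification Q =
     {((f, linepath (\<i> ^ i) (\<i> ^ Suc i) t), (g, linepath (\<i> ^ j) (\<i> ^ Suc j) (1 - t))) | f i g j t.
        ((f, i), (g, j)) \<in> glue Q \<and> t \<in> {0..1}}"

text \<open>
  The surface is the quotient of the disjoint union of the squares by the equivalence relation that
  the identification of sides generates (it is symmetric because \<open>glue Q\<close> is). A side that is glued to
  no other side lies on the boundary of the surface.
\<close>

definition quad_graph ::
    "('f, 'm::{t2_space, second_countable_topology}) cell_complex \<Rightarrow> bool" where
  "quad_graph Q \<longleftrightarrow>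
     surface_with_boundary (surface Q) \<and>
     glue Q \<subseteq> (faces Q \<times> {..<4}) \<times> (faces Q \<times> {..<4}) \<and>
     sym (glue Q) \<and> irrefl (glue Q) \<and> single_valued (glue Q) \<and>
     quotient_map (sum_topology (\<lambda>_. top_of_set square) (faces Q)) (top_of_set (surface Q))
       (\<lambda>(f, z). chart Q f z) \<and>
     (\<forall>f\<in>faces Q. \<forall>g\<in>faces Q. \<forall>z\<in>square. \<forall>w\<in>square.
        chart Q f z = chart Q g w \<longleftrightarrow> ((f, z), (g, w)) \<in> (side_identification Q)\<^sup>*)"

definition corner :: "('f, 'm) cell_complex \<Rightarrow> 'f \<Rightarrow> nat \<Rightarrow> 'm" where
  "corner Q f i = chart Q f (\<i> ^ i)"

definition side :: "('f, 'm) cell_complex \<Rightarrow> 'f \<Rightarrow> nat \<Rightarrow> 'm set" where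
  "side Q f i = chart Q f ` closed_segment (\<i> ^ i) (\<i> ^ Suc i)"

definition vertices :: "('f, 'm) cell_complex \<Rightarrow> 'm set" where
  "vertices Q = {corner Q f i | f i. f \<in> faces Q \<and> i < 4}"

definition edges :: "('f, 'm) cell_complex \<Rightarrow> 'm set set" where
  "edges Q = {side Q f i | f i. f \<in> faces Q \<and> i < 4}"

definition joins :: "('f, 'm) cell_complex \<Rightarrow> 'm set \<Rightarrow> 'm \<Rightarrow> 'm \<Rightarrow> bool" where
  "joins Q e a b \<longleftrightarrow>
     (\<exists>f\<in>faces Q. \<exists>i<4. e = side Q f i \<and> {a, b} = {corner Q f i, corner Q f (Suc i)})"

definition adjacent :: "('f, 'm) cell_complex \<Rightarrow> 'm \<Rightarrow> 'm \<Rightarrow> bool" where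
  "adjacent Q a b \<longleftrightarrow> (\<exists>e. joins Q e a b)"

text \<open>
  Edges are closed arcs, and the vertices on an edge are its end points. Counting edges gives the
  degree because the graphs below are bipartite and hence have no loops.
\<close>

definition degree :: "('f, 'm) cell_complex \<Rightarrow> 'm \<Rightarrow> nat" where
  "degree Q v = card {e \<in> edges Q. v \<in> e}"

datatype vertex_kind = Black | White_c | White_s

definition S_quad_graph ::
    "('f, 'm::{t2_space, second_countable_topology}) cell_complex \<Rightarrow> ('m \<Rightarrow> vertex_kind) \<Rightarrow> bool" where
  "S_quad_graph Q \<kappa> \<longleftrightarrow>
     quad_graph Q \<and>
     (\<forall>v \<in> vertices Q \<inter> surface_interior (surface Q). even (degree Q v)) \<and>
     (\<forall>v \<in> vertices Q \<inter> surface_interior (surface Q). \<kappa> v = Black \<longrightarrow> degree Q v = 4) \<and>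
     (\<forall>a b. adjacent Q a b \<longrightarrow> (\<kappa> a = Black \<longleftrightarrow> \<kappa> b \<noteq> Black)) \<and>
     (\<forall>f\<in>faces Q. (\<exists>!i. i < 4 \<and> \<kappa> (corner Q f i) = White_c) \<and>
                   (\<exists>!i. i < 4 \<and> \<kappa> (corner Q f i) = White_s))"

text \<open>The edge labels \<open>+\<close> and \<open>-\<close> are represented by the numbers \<open>1\<close> and \<open>-1\<close>.\<close>

definition edge_labelling :: "('f, 'm) cell_complex \<Rightarrow> ('m set \<Rightarrow> real) \<Rightarrow> bool" where
  "edge_labelling Q \<epsilon> \<longleftrightarrow>
     (\<forall>e\<in>edges Q. \<epsilon> e \<in> {1, -1}) \<and>
     (\<forall>f\<in>faces Q. \<epsilon> (side Q f 0) = \<epsilon> (side Q f 2) \<and> \<epsilon> (side Q f 1) = \<epsilon> (side Q f 3) \<and>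
                   \<epsilon> (side Q f 0) \<noteq> \<epsilon> (side Q f 1))"


section \<open>Orthogonal circle patterns\<close>

text \<open>
  These predicates are used for circles, which are the spheres of type \<^typ>\<open>complex set\<close>, and for
  spheres in space. Two spheres intersect orthogonally at \<open>p\<close> if their radii to \<open>p\<close> are orthogonal.
\<close>

definition touch_externally_at ::
    "'a::euclidean_space \<Rightarrow> real \<Rightarrow> 'a \<Rightarrow> real \<Rightarrow> 'a \<Rightarrow> bool" where
  "touch_externally_at a r b s p \<longleftrightarrow> p \<in> sphere a r \<inter> sphere b s \<and> dist a b = r + s"

definition orthogonal_at ::
    "'a::euclidean_space \<Rightarrow> real \<Rightarrow> 'a \<Rightarrow> real \<Rightarrow> 'a \<Rightarrow> bool" where
  "orthogonal_at a r b s p \<longleftrightarrow> p \<in> sphere a r \<inter> sphere b s \<and> orthogonal (p - a) (p - b)"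

text \<open>\<open>c\<close> gives the centres and intersection points, \<open>\<rho>\<close> the radii of the circles.\<close>

definition orthogonal_circle_pattern ::
    "('f, 'm) cell_complex \<Rightarrow> ('m \<Rightarrow> vertex_kind) \<Rightarrow> ('m \<Rightarrow> complex) \<Rightarrow> ('m \<Rightarrow> real) \<Rightarrow> bool" where
  "orthogonal_circle_pattern Q \<kappa> c \<rho> \<longleftrightarrow>
     (\<forall>x\<in>vertices Q. \<kappa> x \<noteq> Black \<longrightarrow> 0 < \<rho> x) \<and>
     (\<forall>y x. \<kappa> y = Black \<and> adjacent Q y x \<longrightarrow> c y \<in> sphere (c x) (\<rho> x)) \<and>
     (\<forall>y x\<^sub>1 x\<^sub>2. \<kappa> y = Black \<and> adjacent Q y x\<^sub>1 \<and> adjacent Q y x\<^sub>2 \<and> x\<^sub>1 \<noteq> x\<^sub>2 \<longrightarrow>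
        (if \<kappa> x\<^sub>1 = \<kappa> x\<^sub>2 then touch_externally_at (c x\<^sub>1) (\<rho> x\<^sub>1) (c x\<^sub>2) (\<rho> x\<^sub>2) (c y)
         else orthogonal_at (c x\<^sub>1) (\<rho> x\<^sub>1) (c x\<^sub>2) (\<rho> x\<^sub>2) (c y)))"


section \<open>The Koebe polyhedron and its dual\<close>

definition stereo :: "complex \<Rightarrow> real ^ 3" where
  "stereo p = (1 / (1 + (cmod p)\<^sup>2)) *\<^sub>R vector [2 * Re p, 2 * Im p, (cmod p)\<^sup>2 - 1]"

text \<open>The centre of a circle in space is the point of its plane that has equal distance to all its points.\<close>

definition is_circle_centre :: "(real ^ 3) set \<Rightarrow> real ^ 3 \<Rightarrow> bool" where
  "is_circle_centre C z \<longleftrightarrow> z \<in> affine hull C \<and> (\<exists>r. C \<subseteq> sphere z r)"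

text \<open>
  The unit sphere is \<open>sphere 0 1\<close>. The last conjunct says that the edge from \<open>K x\<^sub>1\<close> to \<open>K x\<^sub>2\<close> is
  tangent to it at the point \<open>K y\<close> of this edge. In particular \<open>K x\<^sub>1\<close> and \<open>K x\<^sub>2\<close> lie on different
  sides of \<open>K y\<close>. That the spheres exist means that no circle of an \<open>s\<close>-labelled vertex is projected
  to a great circle.
\<close>

definition koebe_polyhedron ::
    "('f, 'm) cell_complex \<Rightarrow> ('m \<Rightarrow> vertex_kind) \<Rightarrow> ('m \<Rightarrow> complex) \<Rightarrow> ('m \<Rightarrow> real)
      \<Rightarrow> ('m \<Rightarrow> real ^ 3) \<Rightarrow> bool" where
  "koebe_polyhedron Q \<kappa> c \<rho> K \<longleftrightarrow>
     (\<forall>y\<in>vertices Q. \<kappa> y = Black \<longrightarrow> K y = stereo (c y)) \<and>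
     (\<forall>x\<in>vertices Q. \<kappa> x = White_s \<longrightarrow>
        (\<exists>r>0. sphere (K x) r \<inter> sphere 0 1 = stereo ` sphere (c x) (\<rho> x) \<and>
               (\<forall>q \<in> sphere (K x) r \<inter> sphere 0 1. orthogonal_at (K x) r 0 1 q))) \<and>
     (\<forall>x\<in>vertices Q. \<kappa> x = White_c \<longrightarrow> is_circle_centre (stereo ` sphere (c x) (\<rho> x)) (K x)) \<and>
     (\<forall>y x\<^sub>1 x\<^sub>2. \<kappa> y = Black \<and> \<kappa> x\<^sub>1 = White_s \<and> \<kappa> x\<^sub>2 = White_s \<and>
        adjacent Q y x\<^sub>1 \<and> adjacent Q y x\<^sub>2 \<and> x\<^sub>1 \<noteq> x\<^sub>2 \<longrightarrow>
        K y \<in> closed_segment (K x\<^sub>1) (K x\<^sub>2) \<and> orthogonal (K x\<^sub>2 - K x\<^sub>1) (K y))"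

definition dual_map ::
    "('f, 'm) cell_complex \<Rightarrow> ('m set \<Rightarrow> real) \<Rightarrow> ('m \<Rightarrow> real ^ 3) \<Rightarrow> ('m \<Rightarrow> real ^ 3) \<Rightarrow> bool" where
  "dual_map Q \<epsilon> K F \<longleftrightarrow>
     (\<forall>e a b. joins Q e a b \<longrightarrow> F b - F a = (\<epsilon> e / (norm (K b - K a))\<^sup>2) *\<^sub>R (K b - K a))"

definition S_isothermic_minimal_surface ::
    "('f, 'm) cell_complex \<Rightarrow> ('m \<Rightarrow> vertex_kind) \<Rightarrow> ('m set \<Rightarrow> real) \<Rightarrow> ('m \<Rightarrow> complex) \<Rightarrow> ('m \<Rightarrow> real)
      \<Rightarrow> ('m \<Rightarrow> real ^ 3) \<Rightarrow> bool" where
  "S_isothermic_minimal_surface Q \<kappa> \<epsilon> c \<rho> F \<longleftrightarrow>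
     (\<exists>K. koebe_polyhedron Q \<kappa> c \<rho> K \<and> dual_map Q \<epsilon> K F)"

text \<open>
  The sphere of the surface for an \<open>s\<close>-labelled vertex \<open>x\<close> is the sphere with centre \<open>F x\<close> through the
  points \<open>F y\<close> for all (black) neighbours \<open>y\<close> of \<open>x\<close>.
\<close>

definition sphere_radius ::
    "('f, 'm) cell_complex \<Rightarrow> ('m \<Rightarrow> real ^ 3) \<Rightarrow> 'm \<Rightarrow> real \<Rightarrow> bool" where
  "sphere_radius Q F x r \<longleftrightarrow> (\<forall>y. adjacent Q x y \<longrightarrow> F y \<in> sphere (F x) r)"

definition Re_vec :: "complex ^ 3 \<Rightarrow> real ^ 3" where
  "Re_vec v = (\<chi> k. Re (v $ k))"

end

theory Submission
  imports Defs
begin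

text \<open>
  The derivative of the stereographic projection \<open>\<sigma>\<close> at \<open>p\<close> is conformal; rescaled to an isometry it is
  the map \<open>T\<^sub>p\<close> below. A sphere orthogonal to the unit sphere is centred at the pole \<open>K\<close> of the plane of
  the circle \<open>|z - c| = \<rho>\<close>, and if \<open>p\<close> lies on this circle then \<open>K - \<sigma>(p) = (2 / D) T\<^sub>p(c - p)\<close> with
  \<open>D = 1 + |c|\<^sup>2 - \<rho>\<^sup>2\<close>. So \<open>|D| / (2 \<rho>)\<close> is the inverse radius of the sphere, which is the radius of
  the dual sphere, and dualizing the two halves of an edge adds up multiples of the same unit vector
  \<open>T\<^sub>p((c\<^sub>2 - c\<^sub>1) / |c\<^sub>2 - c\<^sub>1|)\<close>. The numbers \<open>D\<close> of both circles are positive: they have the same sign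
  because \<open>\<sigma>(p)\<close> lies between the two centres, and if both were negative then \<open>0\<close> would be in the
  interior of both circles.

  The two edges have the same label because all corners at a vertex are connected by gluings of sides;
  in a corner at a black vertex the two sides have different labels and lead to vertices of different kinds.
\<close>

section \<open>Corners at a vertex\<close>

lemma corner_cong: "\<i> ^ i = \<i> ^ j \<Longrightarrow> corner Q f i = corner Q f j"
  and corner_Suc_cong: "\<i> ^ i = \<i> ^ j \<Longrightarrow> corner Q f (Suc i) = corner Q f (Suc j)"
  and side_cong: "\<i> ^ i = \<i> ^ j \<Longrightarrow> side Q f i = side Q f j"
  by (simp_all add: corner_def side_def)

lemma i_power_mod_4: "\<i> ^ (k mod 4) = \<i> ^ k"
proof -
  have "\<i> ^ k = \<i> ^ (4 * (k div 4) + k mod 4)"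
    by simp
  also have "\<dots> = (\<i> ^ 4) ^ (k div 4) * \<i> ^ (k mod 4)"
    by (simp only: power_add power_mult)
  finally show ?thesis by simp
qed

lemma corner_mod_4: "corner Q f (k mod 4) = corner Q f k"
  and corner_Suc_mod_4: "corner Q f (Suc (k mod 4)) = corner Q f (Suc k)"
  and side_mod_4: "side Q f (k mod 4) = side Q f k"
  by (simp_all add: corner_def side_def i_power_mod_4)

lemma corner_in_vertices:
  assumes "f \<in> faces Q"
  shows "corner Q f k \<in> vertices Q"
proof -
  have "corner Q f (k mod 4) \<in> vertices Q"
    unfolding vertices_def using assms by (blast intro: mod_less_divisor zero_less_numeral)
  thus ?thesis by (simp only: corner_mod_4)
qed

lemma joins_side:
  assumes "f \<in> faces Q"
  shows "joins Q (side Q f k) (corner Q f k) (corner Q f (Suc k))"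
proof -
  have "k mod 4 < 4" by simp
  hence "joins Q (side Q f (k mod 4)) (corner Q f (k mod 4)) (corner Q f (Suc (k mod 4)))"
    unfolding joins_def using assms by blast
  thus ?thesis by (simp only: corner_mod_4 corner_Suc_mod_4 side_mod_4)
qed

lemma joins_sym: "joins Q e a b \<longleftrightarrow> joins Q e b a"
  by (simp add: joins_def insert_commute)

lemma adjacent_sym: "adjacent Q a b \<longleftrightarrow> adjacent Q b a"
  by (simp add: adjacent_def joins_sym)

lemma joins_in_edges: "joins Q e a b \<Longrightarrow> e \<in> edges Q"
  by (auto simp: joins_def edges_def)

lemma adjacent_in_vertices: "adjacent Q a b \<Longrightarrow> a \<in> vertices Q"
  by (auto simp: adjacent_def joins_def doubleton_eq_iff corner_in_vertices)

lemma linepath_in_square: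
  assumes "t \<in> {0..1}"
  shows "linepath (\<i> ^ i) (\<i> ^ Suc i) t \<in> square"
proof -
  have "closed_segment (\<i> ^ i) (\<i> ^ Suc i) \<subseteq> square"
    unfolding square_def by (intro closed_segment_subset convex_convex_hull hull_inc rangeI)
  moreover have "linepath (\<i> ^ i) (\<i> ^ Suc i) t \<in> closed_segment (\<i> ^ i) (\<i> ^ Suc i)"
    using assms by (rule linepath_in_path)
  ultimately show ?thesis by blast
qed

lemma i_power_in_square: "\<i> ^ i \<in> square"
  using linepath_in_square[of 0 i] by (simp add: linepath_0')

text \<open>The sides of the square are chords of the unit circle and meet it only at their ends: up
  to rotation a point of a side is \<open>Complex (1 - t) t\<close>, which has modulus 1 only at
  \<open>t = 0\<close> or \<open>t = 1\<close>. Hence gluing can identify a corner only with a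
  corner.\<close>

lemma linepath_eq_i_power:
  assumes "linepath (\<i> ^ i) (\<i> ^ Suc i) t = \<i> ^ k"
  shows "t = 0 \<or> t = 1"
proof -
  have "linepath (\<i> ^ i) (\<i> ^ Suc i) t = \<i> ^ i * Complex (1 - t) t"
    by (simp add: linepath_def scaleR_conv_of_real complex_eq_iff algebra_simps)
  hence "cmod (Complex (1 - t) t) = 1"
    using arg_cong[OF assms, of cmod] by (simp add: norm_mult norm_power)
  hence "(1 - t)\<^sup>2 + t\<^sup>2 = 1"
    by (simp add: complex_norm)
  hence "t * (t - 1) = 0"
    by (simp add: power2_eq_square algebra_simps)
  thus ?thesis by auto
qed

text \<open>A side seen from one of its ends \<open>z\<close>, with its image \<open>e\<close> and
  the image \<open>v\<close> of the other end. The end is recorded as a point of the square and not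
  of the surface, because a chart may send several corners of a face to one vertex. The disjunction
  covers the two directions of the side.\<close>

definition spoke :: "('f, 'm) cell_complex \<Rightarrow> 'f \<Rightarrow> complex \<Rightarrow> 'm set \<Rightarrow> 'm \<Rightarrow> bool" where
  "spoke Q f z e v \<longleftrightarrow>
     (\<exists>i. e = side Q f i \<and>
        (z = \<i> ^ i \<and> v = corner Q f (Suc i) \<or> z = \<i> ^ Suc i \<and> v = corner Q f i))"

lemma spoke_in_square: "spoke Q f z e v \<Longrightarrow> z \<in> square"
  using i_power_in_square unfolding spoke_def by metis

lemma joins_imp_spoke:
  assumes "joins Q e v y"
  obtains f z where "f \<in> faces Q" "chart Q f z = y" "spoke Q f z e v"
proof -
  obtain f i where f: "f \<in> faces Q" "e = side Q f i" "{v, y} = {corner Q f i, corner Q f (Suc i)}"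
    using assms by (auto simp: joins_def)
  from f(3) consider "v = corner Q f i" "y = corner Q f (Suc i)"
    | "v = corner Q f (Suc i)" "y = corner Q f i"
    by (auto simp: doubleton_eq_iff)
  thus ?thesis
  proof cases
    case 1
    thus ?thesis using f that[of f "\<i> ^ Suc i"] by (auto simp: spoke_def corner_def)
  next
    case 2
    thus ?thesis using f that[of f "\<i> ^ i"] by (auto simp: spoke_def corner_def)
  qed
qed

section \<open>Effect of gluing on charts, sides and corners\<close>

lemma chart_eq_iff:
  assumes "quad_graph Q" "f \<in> faces Q" "g \<in> faces Q" "z \<in> square" "w \<in> square"
  shows "chart Q f z = chart Q g w \<longleftrightarrow> ((f, z), (g, w)) \<in> (side_identification Q)\<^sup>*"
  using assms unfolding quad_graph_def by blast

lemma glued_chart_eq: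
  assumes Q: "quad_graph Q" and g: "((f, i), (g, j)) \<in> glue Q" and t: "t \<in> {0..1}"
  shows "chart Q f (linepath (\<i> ^ i) (\<i> ^ Suc i) t) = chart Q g (linepath (\<i> ^ j) (\<i> ^ Suc j) (1 - t))"
proof -
  have "f \<in> faces Q" "g \<in> faces Q"
    using Q g unfolding quad_graph_def by auto
  moreover have "((f, linepath (\<i> ^ i) (\<i> ^ Suc i) t), (g, linepath (\<i> ^ j) (\<i> ^ Suc j) (1 - t)))
      \<in> side_identification Q"
    unfolding side_identification_def using g t by blast
  ultimately show ?thesis
    using chart_eq_iff[OF Q] linepath_in_square t
    by (metis atLeastAtMost_iff diff_ge_0_iff_ge diff_le_eq le_add_same_cancel1 r_into_rtrancl)
qed

lemma glued_side_eq:
  assumes Q: "quad_graph Q" and g: "((f, i), (g, j)) \<in> glue Q"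
  shows "side Q f i = side Q g j"
proof -
  have "sym (glue Q)"
    using Q by (simp add: quad_graph_def)
  hence g': "((g, j), (f, i)) \<in> glue Q"
    using g by (rule symD)
  have "side Q f i \<subseteq> side Q g j" if "((f, i), (g, j)) \<in> glue Q" for f g i j
  proof
    fix v assume "v \<in> side Q f i"
    then obtain t where t: "t \<in> {0..1}" "v = chart Q f (linepath (\<i> ^ i) (\<i> ^ Suc i) t)"
      unfolding side_def linepath_image_01[symmetric] by auto
    hence "v = chart Q g (linepath (\<i> ^ j) (\<i> ^ Suc j) (1 - t))" "1 - t \<in> {0..1}"
      using glued_chart_eq[OF Q that] by auto
    thus "v \<in> side Q g j"
      unfolding side_def linepath_image_01[symmetric] by blast
  qed
  thus ?thesis using g g' by blast
qed

lemma glued_corner_eq: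
  assumes "quad_graph Q" "((f, i), (g, j)) \<in> glue Q"
  shows "corner Q f i = corner Q g (Suc j)" "corner Q f (Suc i) = corner Q g j"
  using glued_chart_eq[OF assms, of 0] glued_chart_eq[OF assms, of 1]
  by (simp_all only: corner_def linepath_0' linepath_1' atLeastAtMost_iff order.refl zero_le_one
      simp_thms diff_zero diff_self)

text \<open>Since \<open>\<i> ^ k\<close> is a corner, the parameter of the identified points is 0
  or 1. So \<open>z\<close> is a corner too, and the glued side itself is a spoke of both
  corners.\<close>

lemma side_identification_common_spoke:
  assumes Q: "quad_graph Q" and "((f, z), (g, \<i> ^ k)) \<in> side_identification Q"
  obtains e v where "f \<in> faces Q" "g \<in> faces Q" "spoke Q f z e v" "spoke Q g (\<i> ^ k) e v"
proof -
  obtain i j t where g: "((f, i), (g, j)) \<in> glue Q"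
    and z: "z = linepath (\<i> ^ i) (\<i> ^ Suc i) t"
    and k: "\<i> ^ k = linepath (\<i> ^ j) (\<i> ^ Suc j) (1 - t)"
    using assms(2) unfolding side_identification_def by blast
  have fg: "f \<in> faces Q" "g \<in> faces Q"
    using Q g unfolding quad_graph_def by auto
  from linepath_eq_i_power[OF k[symmetric]] consider "t = 0" | "t = 1" by auto
  thus ?thesis
  proof cases
    case 1
    hence "z = \<i> ^ i" "\<i> ^ k = \<i> ^ Suc j"
      using z k by (simp_all only: linepath_0' linepath_1' diff_zero)
    hence "spoke Q f z (side Q f i) (corner Q f (Suc i))"
      "spoke Q g (\<i> ^ k) (side Q f i) (corner Q f (Suc i))"
      using glued_side_eq[OF Q g] glued_corner_eq[OF Q g] unfolding spoke_def by blast+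
    thus ?thesis using that fg by blast
  next
    case 2
    hence "z = \<i> ^ Suc i" "\<i> ^ k = \<i> ^ j"
      using z k by (simp_all only: linepath_0' linepath_1' diff_self)
    hence "spoke Q f z (side Q f i) (corner Q f i)"
      "spoke Q g (\<i> ^ k) (side Q f i) (corner Q f i)"
      using glued_side_eq[OF Q g] glued_corner_eq[OF Q g] unfolding spoke_def by blast+
    thus ?thesis using that fg by blast
  qed
qed

text \<open>Encodes the labels s and c as signs, so that
  \<open>kind_sign (\<kappa> v) * \<epsilon> e\<close> can serve as an invariant of all spokes at a
  black vertex.\<close>

definition kind_sign :: "vertex_kind \<Rightarrow> real" where
  "kind_sign k = (if k = White_s then 1 else -1)"

lemma edge_label_Suc:
  assumes "edge_labelling Q \<epsilon>" "f \<in> faces Q"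
  shows "\<epsilon> (side Q f (Suc k)) = - \<epsilon> (side Q f k)"
proof -
  have "side Q f i \<in> edges Q" if "i < 4" for i
    using that assms(2) by (auto simp: edges_def)
  hence e: "\<epsilon> (side Q f i) = 1 \<or> \<epsilon> (side Q f i) = -1" if "i < 4" for i
    using assms(1) that by (auto simp: edge_labelling_def)
  have l: "\<epsilon> (side Q f 0) = \<epsilon> (side Q f 2)" "\<epsilon> (side Q f 1) = \<epsilon> (side Q f 3)"
    "\<epsilon> (side Q f 0) \<noteq> \<epsilon> (side Q f 1)"
    using assms by (auto simp: edge_labelling_def)
  have m: "side Q f (Suc k) = side Q f (Suc k mod 4)" "side Q f k = side Q f (k mod 4)"
    by (simp_all only: side_mod_4)
  have "k mod 4 = 0 \<and> Suc k mod 4 = 1 \<or> k mod 4 = 1 \<and> Suc k mod 4 = 2 \<or>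
      k mod 4 = 2 \<and> Suc k mod 4 = 3 \<or> k mod 4 = 3 \<and> Suc k mod 4 = 0"
    by presburger
  moreover have "\<epsilon> (side Q f 1) = - \<epsilon> (side Q f 0)"
    using e[of 0] e[of 1] l(3) by auto
  ultimately show ?thesis
    unfolding m using l(1,2) by (elim disjE conjE) (simp_all only: minus_minus)
qed

text \<open>The two neighbours of a black corner in its face are white. They sit at different
  indices modulo 4, so the uniqueness of each white kind in the face makes their kinds
  differ.\<close>

lemma kind_sign_opposite:
  assumes "S_quad_graph Q \<kappa>" "f \<in> faces Q" "\<kappa> (corner Q f (Suc k)) = Black"
  shows "kind_sign (\<kappa> (corner Q f (Suc (Suc k)))) = - kind_sign (\<kappa> (corner Q f k))"
proof -
  have bip: "\<kappa> (corner Q f i) = Black \<longleftrightarrow> \<kappa> (corner Q f (Suc i)) \<noteq> Black" for i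
    using assms(1) joins_side[OF assms(2), of i] unfolding S_quad_graph_def adjacent_def by blast
  have white: "\<kappa> (corner Q f k) \<noteq> Black" "\<kappa> (corner Q f (Suc (Suc k))) \<noteq> Black"
    using assms(3) bip[of k] bip[of "Suc k"] by auto
  have unique: "\<exists>!i. i < 4 \<and> \<kappa> (corner Q f i) = White_s" "\<exists>!i. i < 4 \<and> \<kappa> (corner Q f i) = White_c"
    using assms(1,2) unfolding S_quad_graph_def by blast+
  have "\<kappa> (corner Q f (Suc (Suc k))) \<noteq> \<kappa> (corner Q f k)"
  proof
    assume eq: "\<kappa> (corner Q f (Suc (Suc k))) = \<kappa> (corner Q f k)"
    have "k mod 4 \<noteq> Suc (Suc k) mod 4" by presburger
    have "k mod 4 < 4" "Suc (Suc k) mod 4 < 4" by auto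
    have "\<kappa> (corner Q f k) \<noteq> w"
      if ex1: "\<exists>!i. i < 4 \<and> \<kappa> (corner Q f i) = w" for w
    proof -
      obtain i where i: "\<And>j. j < 4 \<and> \<kappa> (corner Q f j) = w \<Longrightarrow> j = i"
        using ex1 by blast
      have "\<kappa> (corner Q f k) = w \<Longrightarrow> k mod 4 = i \<and> Suc (Suc k) mod 4 = i"
        using i[of "k mod 4"] i[of "Suc (Suc k) mod 4"] \<open>k mod 4 < 4\<close> \<open>Suc (Suc k) mod 4 < 4\<close>
        unfolding corner_mod_4 eq by blast
      thus ?thesis using \<open>k mod 4 \<noteq> Suc (Suc k) mod 4\<close> by metis
    qed
    hence "\<kappa> (corner Q f k) \<noteq> White_s" "\<kappa> (corner Q f k) \<noteq> White_c"
      using unique by blast+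
    thus False using white(1) vertex_kind.exhaust by blast
  qed
  thus ?thesis
    using white
    by (cases "\<kappa> (corner Q f (Suc (Suc k)))"; cases "\<kappa> (corner Q f k)")
      (simp_all add: kind_sign_def)
qed

text \<open>Two spokes at one corner of a face are either the same side or consecutive sides. In the
  second case both factors of the product change sign.\<close>

lemma spokes_same_corner:
  assumes S: "S_quad_graph Q \<kappa>" and E: "edge_labelling Q \<epsilon>" and f: "f \<in> faces Q"
    and black: "\<kappa> (chart Q f z) = Black"
    and "spoke Q f z e v" "spoke Q f z e' v'"
  shows "kind_sign (\<kappa> v) * \<epsilon> e = kind_sign (\<kappa> v') * \<epsilon> e'"
proof -
  have consecutive: "kind_sign (\<kappa> (corner Q f i)) * \<epsilon> (side Q f i) =
      kind_sign (\<kappa> (corner Q f (Suc j))) * \<epsilon> (side Q f j)"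
    if "z = \<i> ^ Suc i" "z = \<i> ^ j" for i j
  proof -
    have ij: "\<i> ^ j = \<i> ^ Suc i" using that by simp
    have "\<kappa> (corner Q f (Suc i)) = Black"
      using black that by (simp add: corner_def)
    hence "kind_sign (\<kappa> (corner Q f (Suc (Suc i)))) = - kind_sign (\<kappa> (corner Q f i))"
      by (rule kind_sign_opposite[OF S f])
    thus ?thesis
      using edge_label_Suc[OF E f, of i] corner_Suc_cong[OF ij, of Q f] side_cong[OF ij, of Q f]
      by simp
  qed
  obtain i where i: "e = side Q f i"
    "z = \<i> ^ i \<and> v = corner Q f (Suc i) \<or> z = \<i> ^ Suc i \<and> v = corner Q f i"
    using assms(5) unfolding spoke_def by blast
  obtain j where j: "e' = side Q f j"
    "z = \<i> ^ j \<and> v' = corner Q f (Suc j) \<or> z = \<i> ^ Suc j \<and> v' = corner Q f j"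
    using assms(6) unfolding spoke_def by blast
  consider "z = \<i> ^ i" "v = corner Q f (Suc i)" "z = \<i> ^ j" "v' = corner Q f (Suc j)"
    | "z = \<i> ^ Suc i" "v = corner Q f i" "z = \<i> ^ Suc j" "v' = corner Q f j"
    | "z = \<i> ^ Suc i" "v = corner Q f i" "z = \<i> ^ j" "v' = corner Q f (Suc j)"
    | "z = \<i> ^ i" "v = corner Q f (Suc i)" "z = \<i> ^ Suc j" "v' = corner Q f j"
    using i(2) j(2) by blast
  thus ?thesis
  proof cases
    case 1
    hence "\<i> ^ i = \<i> ^ j" by simp
    thus ?thesis using 1 i(1) j(1) side_cong corner_Suc_cong by metis
  next
    case 2
    hence "\<i> ^ i = \<i> ^ j" by simp
    thus ?thesis using 2 i(1) j(1) side_cong corner_cong by metis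
  next
    case 3
    thus ?thesis using i(1) j(1) consecutive by simp
  next
    case 4
    thus ?thesis using i(1) j(1) consecutive[of j i] by simp
  qed
qed

text \<open>Induction along the chain of gluings that connects the two corners. Each gluing step
  offers a spoke common to the old and the new corner, and at the new corner this spoke is compared
  with the given one.\<close>

lemma spokes_same_vertex:
  assumes S: "S_quad_graph Q \<kappa>" and E: "edge_labelling Q \<epsilon>"
    and f: "f \<in> faces Q" and black: "\<kappa> (chart Q f z) = Black"
    and sp: "spoke Q f z e v"
    and "((f, z), (g, w)) \<in> (side_identification Q)\<^sup>*" "spoke Q g w e' v'"
  shows "kind_sign (\<kappa> v) * \<epsilon> e = kind_sign (\<kappa> v') * \<epsilon> e'"
  using assms(6,7)
proof (induction "(g, w)" arbitrary: g w e' v' rule: rtrancl_induct)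
  case base
  thus ?case using spokes_same_corner[OF S E f black sp] by simp
next
  case (step a)
  obtain h u where a: "a = (h, u)" by fastforce
  have Q: "quad_graph Q" using S by (simp add: S_quad_graph_def)
  obtain k where k: "w = \<i> ^ k" using step.prems unfolding spoke_def by blast
  obtain d x where d: "h \<in> faces Q" "g \<in> faces Q" "spoke Q h u d x" "spoke Q g w d x"
    using side_identification_common_spoke[OF Q, of h u g k] step.hyps(2) a k by metis
  \<comment> \<open>The new corner is mapped to the same vertex as the first one, so it is black as
    well.\<close>
  have "((f, z), (g, w)) \<in> (side_identification Q)\<^sup>*"
    using step.hyps(1,2) by (rule rtrancl_into_rtrancl)
  hence "chart Q g w = chart Q f z"
    using chart_eq_iff[OF Q f d(2) spoke_in_square[OF sp] spoke_in_square[OF d(4)]] by simp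
  hence "kind_sign (\<kappa> x) * \<epsilon> d = kind_sign (\<kappa> v') * \<epsilon> e'"
    using spokes_same_corner[OF S E d(2) _ d(4) step.prems] black by simp
  thus ?case using step.hyps(3)[OF a d(3)] by simp
qed

lemma edge_labels_at_black_vertex:
  assumes S: "S_quad_graph Q \<kappa>" and E: "edge_labelling Q \<epsilon>" and "\<kappa> y = Black"
    and "joins Q e\<^sub>1 x\<^sub>1 y" "joins Q e\<^sub>2 x\<^sub>2 y" and "\<kappa> x\<^sub>1 = White_s" "\<kappa> x\<^sub>2 = White_s"
  shows "\<epsilon> e\<^sub>1 = \<epsilon> e\<^sub>2"
proof -
  obtain f z where f: "f \<in> faces Q" "chart Q f z = y" "spoke Q f z e\<^sub>1 x\<^sub>1"
    using assms(4) by (rule joins_imp_spoke)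
  obtain g w where g: "g \<in> faces Q" "chart Q g w = y" "spoke Q g w e\<^sub>2 x\<^sub>2"
    using assms(5) by (rule joins_imp_spoke)
  have "quad_graph Q" using S by (simp add: S_quad_graph_def)
  hence "((f, z), (g, w)) \<in> (side_identification Q)\<^sup>*"
    using chart_eq_iff f g spoke_in_square by metis
  hence "kind_sign (\<kappa> x\<^sub>1) * \<epsilon> e\<^sub>1 = kind_sign (\<kappa> x\<^sub>2) * \<epsilon> e\<^sub>2"
    using spokes_same_vertex[OF S E f(1) _ f(3) _ g(3)] f(2) assms(3) by simp
  thus ?thesis using assms by (simp add: kind_sign_def)
qed


section \<open>Spheres orthogonal to the unit sphere\<close>

lemma norm_vec_3: "(norm (v :: real ^ 3))\<^sup>2 = (v $ 1)\<^sup>2 + (v $ 2)\<^sup>2 + (v $ 3)\<^sup>2"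
  by (simp add: power2_norm_eq_inner inner_vec_def sum_3 flip: power2_eq_square)

text \<open>The map \<open>T\<close> at \<open>p\<close> of the introduction, that is
  \<open>(1 + (cmod p)\<^sup>2) / 2\<close> times the derivative of \<open>stereo\<close> at
  \<open>p\<close> in direction \<open>d\<close>. It is written with the Weierstrass vector so that
  the final formula appears by unfolding.\<close>

definition stereo_tangent :: "complex \<Rightarrow> complex \<Rightarrow> real ^ 3" where
  "stereo_tangent p d =
     Re_vec ((cnj d / of_real (1 + (cmod p)\<^sup>2)) *s vector [1 - p\<^sup>2, \<i> * (1 + p\<^sup>2), 2 * p])"

lemma stereo_tangent_eq:
  "stereo_tangent p d = (let n = 2 * inner d p / (1 + (cmod p)\<^sup>2)
     in vector [Re d - n * Re p, Im d - n * Im p, n])"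
proof -
  define N where "N = 1 + (cmod p)\<^sup>2"
  \<comment> \<open>In terms of \<open>u\<close> and \<open>p\<close> no denominators remain, and
    the claim becomes a polynomial identity.\<close>
  define u where "u = d / of_real N"
  have N: "N \<noteq> 0"
    unfolding N_def using zero_le_power2[of "cmod p"] by linarith
  have N_eq: "N = 1 + (Re p)\<^sup>2 + (Im p)\<^sup>2"
    by (simp add: N_def cmod_power2)
  have d: "d = N *\<^sub>R u"
    using N by (simp add: u_def scaleR_conv_of_real)
  have n: "2 * inner d p / N = 2 * (Re u * Re p + Im u * Im p)"
    unfolding d inner_scaleR_left using N by (simp add: inner_complex_def)
  have "cnj d / of_real N = cnj u"
    by (simp add: u_def)
  thus ?thesis
    unfolding stereo_tangent_def N_def[symmetric] Let_def n
    by (simp add: d N_eq Re_vec_def vec_eq_iff forall_3 power2_eq_square algebra_simps)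
qed

lemma stereo_tangent_scaleR: "stereo_tangent p (a *\<^sub>R d) = a *\<^sub>R stereo_tangent p d"
  by (simp add: stereo_tangent_eq Let_def vec_eq_iff forall_3 algebra_simps)

text \<open>In real coordinates the squared norm is \<open>(cmod d)\<^sup>2 - 2 * n * inner d p +
  n\<^sup>2 * (1 + (cmod p)\<^sup>2)\<close>, and the choice of \<open>n\<close> makes the last two
  terms cancel.\<close>

lemma norm_stereo_tangent: "norm (stereo_tangent p d) = cmod d"
proof -
  define n where "n = 2 * inner d p / (1 + (cmod p)\<^sup>2)"
  have "1 + (cmod p)\<^sup>2 \<noteq> 0"
    using zero_le_power2[of "cmod p"] by linarith
  hence "n * (1 + (cmod p)\<^sup>2) = 2 * inner d p"
    by (simp add: n_def)
  hence n: "n * (1 + (Re p)\<^sup>2 + (Im p)\<^sup>2) = 2 * (Re d * Re p + Im d * Im p)"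
    by (simp add: cmod_power2 inner_complex_def add.assoc)
  have "(norm (stereo_tangent p d))\<^sup>2 = (Re d - n * Re p)\<^sup>2 + (Im d - n * Im p)\<^sup>2 + n\<^sup>2"
    unfolding norm_vec_3 stereo_tangent_eq n_def[symmetric] Let_def by simp
  also have "\<dots> = (Re d)\<^sup>2 + (Im d)\<^sup>2"
    using n by algebra
  finally have "(norm (stereo_tangent p d))\<^sup>2 = (cmod d)\<^sup>2"
    by (simp add: cmod_power2)
  thus ?thesis by simp
qed

lemma norm_stereo: "norm (stereo p) = 1"
proof -
  define N where "N = 1 + (Re p)\<^sup>2 + (Im p)\<^sup>2"
  have N: "N > 0" unfolding N_def by (simp add: add_pos_nonneg)
  have cm: "(cmod p)\<^sup>2 = N - 1"
    by (simp add: N_def cmod_power2)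
  have "(norm (stereo p))\<^sup>2 = (2 * Re p / N)\<^sup>2 + (2 * Im p / N)\<^sup>2 + ((N - 2) / N)\<^sup>2"
    unfolding norm_vec_3 stereo_def cm by simp
  also have "\<dots> = (4 * (Re p)\<^sup>2 + 4 * (Im p)\<^sup>2 + (N - 2)\<^sup>2) / N\<^sup>2"
    by (simp add: power_divide add_divide_distrib power_mult_distrib)
  also have "4 * (Re p)\<^sup>2 + 4 * (Im p)\<^sup>2 + (N - 2)\<^sup>2 = N\<^sup>2"
    unfolding N_def by algebra
  finally have "(norm (stereo p))\<^sup>2 = 1" using N by simp
  thus ?thesis by (simp add: power2_eq_1_iff) (metis norm_ge_zero not_one_le_zero neg_0_le_iff_le)
qed

text \<open>Clearing the denominator turns the polar plane of \<open>k\<close> into the equation of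
  a circle or line in the plane, whose coefficients can be compared with a given circle.\<close>

lemma inner_stereo_eq_1_iff:
  "inner k (stereo z) = 1 \<longleftrightarrow>
     2 * k $ 1 * Re z + 2 * k $ 2 * Im z + k $ 3 * ((cmod z)\<^sup>2 - 1) = 1 + (cmod z)\<^sup>2"
proof -
  define l where "l = 2 * k $ 1 * Re z + 2 * k $ 2 * Im z + k $ 3 * ((cmod z)\<^sup>2 - 1)"
  have "1 + (cmod z)\<^sup>2 \<noteq> 0"
    using zero_le_power2[of "cmod z"] by linarith
  moreover have "inner k (stereo z) = l / (1 + (cmod z)\<^sup>2)"
    by (simp add: stereo_def l_def inner_vec_def sum_3 add_divide_distrib mult_ac)
  ultimately show ?thesis
    unfolding l_def[symmetric] by auto
qed

lemma pole_coordinates: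
  assumes \<rho>: "0 < \<rho>" and k: "\<And>z. z \<in> sphere c \<rho> \<Longrightarrow> inner k (stereo z) = 1"
  shows "k $ 1 = (1 - k $ 3) * Re c" "k $ 2 = (1 - k $ 3) * Im c"
    "(1 - k $ 3) * (1 + (cmod c)\<^sup>2 - \<rho>\<^sup>2) = 2"
proof -
  have eq: "2 * k $ 1 * (Re c + Re w) + 2 * k $ 2 * (Im c + Im w)
      + k $ 3 * ((Re c + Re w)\<^sup>2 + (Im c + Im w)\<^sup>2 - 1) = 1 + ((Re c + Re w)\<^sup>2 + (Im c + Im w)\<^sup>2)"
    if "cmod w = \<rho>" for w
    using k[of "c + w"] that unfolding inner_stereo_eq_1_iff
    by (simp add: dist_norm cmod_power2)
  \<comment> \<open>Subtracting the equations at two opposite points of the circle leaves only the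
    terms that are odd in \<open>\<rho>\<close>.\<close>
  have "\<rho> * (k $ 1 - (1 - k $ 3) * Re c) = 0"
    using eq[of "of_real \<rho>"] eq[of "- of_real \<rho>"] \<rho>
    by (simp add: power2_eq_square algebra_simps)
  thus 1: "k $ 1 = (1 - k $ 3) * Re c" using \<rho> by simp
  have "\<rho> * (k $ 2 - (1 - k $ 3) * Im c) = 0"
    using eq[of "\<i> * of_real \<rho>"] eq[of "- (\<i> * of_real \<rho>)"] \<rho>
    by (simp add: norm_mult power2_eq_square algebra_simps)
  thus 2: "k $ 2 = (1 - k $ 3) * Im c" using \<rho> by simp
  have e: "2 * k $ 1 * (Re c + \<rho>) + 2 * k $ 2 * Im c + k $ 3 * ((Re c + \<rho>)\<^sup>2 + (Im c)\<^sup>2 - 1)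
      = 1 + ((Re c + \<rho>)\<^sup>2 + (Im c)\<^sup>2)"
    using eq[of "of_real \<rho>"] \<rho> by simp
  show "(1 - k $ 3) * (1 + (cmod c)\<^sup>2 - \<rho>\<^sup>2) = 2"
    using e unfolding 1 2 cmod_power2 by algebra
qed

lemma pole_minus_stereo:
  assumes "0 < \<rho>" "\<And>z. z \<in> sphere c \<rho> \<Longrightarrow> inner k (stereo z) = 1" and p: "p \<in> sphere c \<rho>"
  defines "D \<equiv> 1 + (cmod c)\<^sup>2 - \<rho>\<^sup>2"
  shows "D \<noteq> 0" "k - stereo p = (2 / D) *\<^sub>R stereo_tangent p (c - p)"
proof -
  \<comment> \<open>Both points are described by their height below the north pole: \<open>k\<close>
    is \<open>(m c, 1 - m)\<close> and \<open>stereo p\<close> is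
    \<open>(n p, 1 - n)\<close>.\<close>
  define m where "m = 1 - k $ 3"
  define n where "n = 2 / (1 + (cmod p)\<^sup>2)"
  define s where "s = inner (c - p) p"
  have pole: "k $ 1 = m * Re c" "k $ 2 = m * Im c" "m * D = 2"
    unfolding m_def D_def using pole_coordinates[of \<rho> c k] assms(1,2) by blast+
  from pole(3) show D: "D \<noteq> 0" by auto
  have N: "1 + (cmod p)\<^sup>2 \<noteq> 0"
    using zero_le_power2[of "cmod p"] by linarith
  have "\<rho>\<^sup>2 = (cmod (c - p))\<^sup>2"
    using p by (simp add: dist_norm)
  hence DN: "D = 1 + (cmod p)\<^sup>2 + 2 * s"
    unfolding D_def s_def
    by (simp only: cmod_power2 minus_complex.sel inner_complex_def)
      (simp add: power2_eq_square algebra_simps)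
  have mD: "m = 2 / D" using pole(3) D by (simp add: field_simps)
  \<comment> \<open>This is \<open>DN\<close> rewritten for the reciprocals \<open>m = 2 / D\<close>
    and \<open>n = 2 / (1 + (cmod p)\<^sup>2)\<close>. All three coordinates follow from it.\<close>
  have mn: "m - n = - m * n * s"
    unfolding mD n_def using D N by (simp add: divide_simps) (simp add: DN)
  have k3: "k $ 3 = 1 - m" by (simp add: m_def)
  have n3: "((cmod p)\<^sup>2 - 1) / (1 + (cmod p)\<^sup>2) = 1 - n"
    unfolding n_def using N by (simp add: divide_simps)
  have st: "stereo p = vector [n * Re p, n * Im p, 1 - n]"
    using n3 by (simp add: stereo_def n_def vec_eq_iff forall_3)
  have tg: "stereo_tangent p (c - p)
      = vector [Re (c - p) - n * s * Re p, Im (c - p) - n * s * Im p, n * s]"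
    by (simp add: stereo_tangent_eq Let_def n_def s_def)
  have "m * x - n * a = m * (x - a - n * s * a)" for x a
    using mn by algebra
  moreover have "1 - m - (1 - n) = m * (n * s)"
    using mn by algebra
  ultimately show "k - stereo p = (2 / D) *\<^sub>R stereo_tangent p (c - p)"
    unfolding mD[symmetric] st tg vec_eq_iff forall_3 vector_minus_component vector_scaleR_component
    by (simp add: pole(1,2) k3)
qed

text \<open>Orthogonality at a point \<open>q\<close> of the unit sphere says
  \<open>inner (q - K x) q = 0\<close>, and \<open>inner q q = 1\<close>. So the centre is the pole
  of the plane of the circle.\<close>

lemma koebe_pole:
  assumes "koebe_polyhedron Q \<kappa> c \<rho> K" "x \<in> vertices Q" "\<kappa> x = White_s" "z \<in> sphere (c x) (\<rho> x)"
  shows "inner (K x) (stereo z) = 1"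
proof -
  obtain r where r: "sphere (K x) r \<inter> sphere 0 1 = stereo ` sphere (c x) (\<rho> x)"
    "\<forall>q \<in> sphere (K x) r \<inter> sphere 0 1. orthogonal_at (K x) r 0 1 q"
    using assms unfolding koebe_polyhedron_def by blast
  have "stereo z \<in> sphere (K x) r \<inter> sphere 0 1"
    using r(1) assms(4) by blast
  hence "inner (stereo z - K x) (stereo z) = 0"
    using r(2) by (force simp: orthogonal_at_def orthogonal_def)
  thus ?thesis
    using norm_stereo[of z] by (simp add: inner_diff_left dot_square_norm)
qed


section \<open>Circles touching externally\<close>

text \<open>External contact is equality in the triangle inequality for \<open>a\<close>,
  \<open>p\<close>, \<open>b\<close>, so \<open>p\<close> divides the segment between the centres in
  the ratio of the radii.\<close>

lemma touching_circles_direction: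
  assumes "touch_externally_at a r b s (p :: complex)" "0 < r" "0 < s"
  defines "d \<equiv> (b - a) /\<^sub>R cmod (b - a)"
  shows "cmod d = 1" "a - p = (- r) *\<^sub>R d" "b - p = s *\<^sub>R d"
proof -
  have ab: "cmod (b - a) = r + s" and pa: "cmod (p - a) = r" and pb: "cmod (b - p) = s"
    using assms(1) by (auto simp: touch_externally_at_def dist_norm norm_minus_commute)
  show "cmod d = 1"
    unfolding d_def using ab assms(2,3) by simp
  have "cmod ((p - a) + (b - p)) = cmod (p - a) + cmod (b - p)"
    using ab pa pb by simp
  hence par: "r *\<^sub>R (b - p) = s *\<^sub>R (p - a)"
    unfolding norm_triangle_eq using pa pb by simp
  have rs: "r + s \<noteq> 0" using assms(2,3) by simp
  have "(r + s) *\<^sub>R (b - p) = s *\<^sub>R (b - a)" "(r + s) *\<^sub>R (a - p) = (- r) *\<^sub>R (b - a)"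
    using par by (simp_all add: algebra_simps)
  hence "b - p = s *\<^sub>R (b - a) /\<^sub>R (r + s)" "a - p = (- r) *\<^sub>R (b - a) /\<^sub>R (r + s)"
    using rs by (metis scaleR_left_imp_eq scaleR_scaleR right_inverse scaleR_one)+
  thus "a - p = (- r) *\<^sub>R d" "b - p = s *\<^sub>R d"
    unfolding d_def ab by (simp_all add: mult.commute)
qed

text \<open>If both numbers were nonpositive, then \<open>0\<close> would lie inside both circles,
  and the centres would be closer than \<open>r + s\<close>.\<close>

lemma touching_circles_common_interior:
  assumes "touch_externally_at a r b s (p :: complex)" "0 < r" "0 < s"
  shows "0 < 1 + (cmod a)\<^sup>2 - r\<^sup>2 \<or> 0 < 1 + (cmod b)\<^sup>2 - s\<^sup>2"
proof (rule ccontr)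
  assume "\<not> ?thesis"
  hence "(cmod a)\<^sup>2 < r\<^sup>2" "(cmod b)\<^sup>2 < s\<^sup>2" by auto
  hence "cmod a < r" "cmod b < s"
    using assms(2,3) by (auto intro: power2_less_imp_less)
  moreover have "cmod (a - b) = r + s"
    using assms(1) by (simp add: touch_externally_at_def dist_norm)
  ultimately show False
    using norm_triangle_ineq4[of a b] by linarith
qed

lemma touching_spheres_signs:
  fixes K\<^sub>1 K\<^sub>2 q t :: "real ^ 3"
  assumes "q \<in> closed_segment K\<^sub>1 K\<^sub>2" "K\<^sub>1 - q = - (\<alpha> *\<^sub>R t)" "K\<^sub>2 - q = \<beta> *\<^sub>R t"
    and "t \<noteq> 0" "\<alpha> \<noteq> 0" "\<beta> \<noteq> 0"
  shows "0 < \<alpha> \<longleftrightarrow> 0 < \<beta>"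
proof -
  obtain u where u: "0 \<le> u" "u \<le> 1" "q = (1 - u) *\<^sub>R K\<^sub>1 + u *\<^sub>R K\<^sub>2"
    using assms(1) by (auto simp: in_segment)
  hence "(1 - u) *\<^sub>R (K\<^sub>1 - q) + u *\<^sub>R (K\<^sub>2 - q) = 0"
    by (simp add: algebra_simps)
  hence "(u * \<beta> - (1 - u) * \<alpha>) *\<^sub>R t = 0"
    unfolding assms(2,3) by (simp add: algebra_simps)
  hence eq: "u * \<beta> = (1 - u) * \<alpha>" using assms(4) by simp
  \<comment> \<open>In \<open>eq\<close>, \<open>u = 0\<close> would give
    \<open>\<alpha> = 0\<close> and \<open>u = 1\<close> would give
    \<open>\<beta> = 0\<close>.\<close>
  hence "u \<noteq> 0" "u \<noteq> 1" using assms(5,6) by auto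
  hence "0 < u" "0 < 1 - u" using u(1,2) by auto
  thus ?thesis using eq by (metis zero_less_mult_pos zero_less_mult_iff)
qed

section \<open>Dualizing the edge between two touching spheres\<close>

theorem theorem6:
  fixes Q :: "('f, 'm::{t2_space, second_countable_topology}) cell_complex"
    and \<kappa> :: "'m \<Rightarrow> vertex_kind" and \<epsilon> :: "'m set \<Rightarrow> real"
    and c :: "'m \<Rightarrow> complex" and \<rho> :: "'m \<Rightarrow> real" and F :: "'m \<Rightarrow> real ^ 3"
    and x\<^sub>1 x\<^sub>2 y :: 'm and e\<^sub>1 e\<^sub>2 :: "'m set" and p :: complex and R :: "'m \<Rightarrow> real"
  assumes "S_quad_graph Q \<kappa>"
    and "simply_connected (surface Q)"
    and "edge_labelling Q \<epsilon>"
    and "orthogonal_circle_pattern Q \<kappa> c \<rho>"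
    and "S_isothermic_minimal_surface Q \<kappa> \<epsilon> c \<rho> F"
    and "x\<^sub>1 \<noteq> x\<^sub>2" and "\<kappa> x\<^sub>1 = White_s" and "\<kappa> x\<^sub>2 = White_s" and "\<kappa> y = Black"
    and "joins Q e\<^sub>1 x\<^sub>1 y" and "joins Q e\<^sub>2 y x\<^sub>2"
    and "p = c y"
    and "\<And>x. R x = \<bar>(1 + (cmod (c x))\<^sup>2 - (cmod (c x - p))\<^sup>2) / (2 * cmod (c x - p))\<bar>"
  shows "sphere_radius Q F x\<^sub>1 (R x\<^sub>1) \<and> sphere_radius Q F x\<^sub>2 (R x\<^sub>2) \<and>
    \<epsilon> e\<^sub>1 = \<epsilon> e\<^sub>2 \<and>
    F x\<^sub>2 - F x\<^sub>1 = \<epsilon> e\<^sub>1 *\<^sub>R Re_vec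
      ((of_real ((R x\<^sub>2 + R x\<^sub>1) / (1 + (cmod p)\<^sup>2)) *
          ((cnj (c x\<^sub>2) - cnj (c x\<^sub>1)) / of_real (cmod (c x\<^sub>2 - c x\<^sub>1)))) *s
        vector [1 - p\<^sup>2, \<i> * (1 + p\<^sup>2), 2 * p])"
proof -
  have bip: "\<kappa> a = Black \<longleftrightarrow> \<kappa> b \<noteq> Black" if "adjacent Q a b" for a b
    using assms(1) that by (auto simp: S_quad_graph_def)
  obtain K where K: "koebe_polyhedron Q \<kappa> c \<rho> K" and dual: "dual_map Q \<epsilon> K F"
    using assms(5) by (auto simp: S_isothermic_minimal_surface_def)
  define D where "D x = 1 + (cmod (c x))\<^sup>2 - (\<rho> x)\<^sup>2" for x
  have \<rho>: "0 < \<rho> x" if "\<kappa> x = White_s" "adjacent Q x v" for x v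
    using assms(4) that adjacent_in_vertices[of Q x v]
    by (auto simp: orthogonal_circle_pattern_def)
  have on: "c v \<in> sphere (c x) (\<rho> x)" if "\<kappa> v = Black" "adjacent Q x v" for x v
    using assms(4) that adjacent_sym[of Q x v] by (auto simp: orthogonal_circle_pattern_def)
  have Kdiff: "D x \<noteq> 0" "K x - K v = (2 / D x) *\<^sub>R stereo_tangent (c v) (c x - c v)"
    if x: "\<kappa> x = White_s" "\<kappa> v = Black" "adjacent Q x v" for x v
  proof -
    have "K v = stereo (c v)"
      using K x adjacent_sym[of Q x v] adjacent_in_vertices[of Q v x]
      unfolding koebe_polyhedron_def by simp
    thus "D x \<noteq> 0" "K x - K v = (2 / D x) *\<^sub>R stereo_tangent (c v) (c x - c v)"
      using pole_minus_stereo[OF \<rho>[OF x(1,3)] koebe_pole[OF K _ x(1)] on[OF x(2,3)]]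
        adjacent_in_vertices[OF x(3)] by (simp_all add: D_def)
  qed
  \<comment> \<open>As \<open>p\<close> lies on the circle of \<open>x\<close>, its distance from
    \<open>c x\<close> is \<open>\<rho> x\<close>. So the value of \<open>R x\<close> depends only
    on the circle and not on which of its points is \<open>p\<close>.\<close>
  have R_eq: "R x = \<bar>D x\<bar> / (2 * \<rho> x)" if "\<kappa> x = White_s" "adjacent Q x y" for x
    using on[OF assms(9) that(2)] \<rho>[OF that]
    by (simp add: assms(12,13) D_def dist_norm abs_divide)
  have radius: "sphere_radius Q F x (R x)" if x: "\<kappa> x = White_s" "adjacent Q x y" for x
    unfolding sphere_radius_def
  proof (intro allI impI)
    fix v assume v: "adjacent Q x v"
    hence black: "\<kappa> v = Black" using bip x(1) by fastforce
    obtain e where e: "joins Q e x v" using v by (auto simp: adjacent_def)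
    have "cmod (c x - c v) = \<rho> x"
      using on[OF black v] by (simp add: dist_norm)
    \<comment> \<open>This length is the same for all neighbours \<open>v\<close> of
      \<open>x\<close>. Dualizing inverts it, which gives one common radius.\<close>
    hence "norm (K x - K v) = 2 * \<rho> x / \<bar>D x\<bar>"
      using Kdiff[OF x(1) black v] \<rho>[OF x] by (simp add: norm_stereo_tangent)
    hence nK: "norm (K v - K x) = 2 * \<rho> x / \<bar>D x\<bar>"
      by (simp add: norm_minus_commute)
    have "\<bar>\<epsilon> e\<bar> = 1"
      using assms(3) joins_in_edges[OF e] by (auto simp: edge_labelling_def)
    hence "norm (F v - F x) = 1 / norm (K v - K x)"
      using dual e by (simp add: dual_map_def power2_eq_square)
    also have "\<dots> = R x"
      unfolding R_eq[OF x] nK by simp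
    finally show "F v \<in> sphere (F x) (R x)"
      by (simp add: dist_norm norm_minus_commute)
  qed
  have adj: "adjacent Q x\<^sub>1 y" "adjacent Q x\<^sub>2 y"
    using assms(10,11) joins_sym[of Q e\<^sub>2 y x\<^sub>2] by (auto simp: adjacent_def)
  have \<epsilon>: "\<epsilon> e\<^sub>1 = \<epsilon> e\<^sub>2"
    using edge_labels_at_black_vertex[OF assms(1,3,9,10) _ assms(7,8)] assms(11) joins_sym by metis
  note r1 = \<rho>[OF assms(7) adj(1)] and r2 = \<rho>[OF assms(8) adj(2)]
  have touch: "touch_externally_at (c x\<^sub>1) (\<rho> x\<^sub>1) (c x\<^sub>2) (\<rho> x\<^sub>2) p"
    using assms(4) adj adjacent_sym[of Q] assms(6-9,12)
    unfolding orthogonal_circle_pattern_def by metis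
  define d where "d = (c x\<^sub>2 - c x\<^sub>1) /\<^sub>R cmod (c x\<^sub>2 - c x\<^sub>1)"
  define t where "t = stereo_tangent p d"
  note dir = touching_circles_direction[OF touch r1 r2, folded d_def]
  define \<alpha> where "\<alpha> = 2 * \<rho> x\<^sub>1 / D x\<^sub>1"
  define \<beta> where "\<beta> = 2 * \<rho> x\<^sub>2 / D x\<^sub>2"
  have nt: "norm t = 1" unfolding t_def norm_stereo_tangent by (rule dir(1))
  have k1: "K x\<^sub>1 - K y = - (\<alpha> *\<^sub>R t)"
    using Kdiff(2)[OF assms(7,9) adj(1), folded assms(12)] unfolding dir(2)
    by (simp only: stereo_tangent_scaleR t_def \<alpha>_def) simp
  have k2: "K x\<^sub>2 - K y = \<beta> *\<^sub>R t"
    using Kdiff(2)[OF assms(8,9) adj(2), folded assms(12)] unfolding dir(3)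
    by (simp only: stereo_tangent_scaleR t_def \<beta>_def) simp
  have D0: "D x\<^sub>1 \<noteq> 0" "D x\<^sub>2 \<noteq> 0"
    using Kdiff(1) assms(7-9) adj by blast+
  have "K y \<in> closed_segment (K x\<^sub>1) (K x\<^sub>2)"
    using K adj adjacent_sym[of Q] assms(6-9) unfolding koebe_polyhedron_def by metis
  hence "0 < \<alpha> \<longleftrightarrow> 0 < \<beta>"
    using touching_spheres_signs[OF _ k1 k2] nt D0 r1 r2 by (fastforce simp: \<alpha>_def \<beta>_def)
  hence "0 < D x\<^sub>1 \<longleftrightarrow> 0 < D x\<^sub>2"
    using r1 r2 by (simp add: \<alpha>_def \<beta>_def zero_less_divide_iff)
  \<comment> \<open>The two numbers have the same sign and are not both negative. Their positivity
    removes the absolute values in \<open>R\<close>.\<close>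
  hence Dpos: "0 < D x\<^sub>1" "0 < D x\<^sub>2"
    using touching_circles_common_interior[OF touch r1 r2] by (auto simp: D_def)
  have "F y - F x\<^sub>1 = (\<epsilon> e\<^sub>1 / (norm (K y - K x\<^sub>1))\<^sup>2) *\<^sub>R (K y - K x\<^sub>1)"
    using dual assms(10) by (simp add: dual_map_def)
  also have "K y - K x\<^sub>1 = \<alpha> *\<^sub>R t"
    using k1 by (simp add: algebra_simps)
  \<comment> \<open>As \<open>t\<close> is a unit vector, dividing \<open>\<alpha> t\<close> by its
    squared norm leaves \<open>t / \<alpha>\<close>, and \<open>1 / \<alpha>\<close> is
    \<open>R\<close> at \<open>x\<^sub>1\<close> because \<open>D\<close> is positive there.\<close>
  finally have F1: "F y - F x\<^sub>1 = (\<epsilon> e\<^sub>1 * R x\<^sub>1) *\<^sub>R t"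
    using nt r1 Dpos by (simp add: R_eq[OF assms(7) adj(1)] \<alpha>_def power2_eq_square)
  have "F x\<^sub>2 - F y = (\<epsilon> e\<^sub>2 / (norm (K x\<^sub>2 - K y))\<^sup>2) *\<^sub>R (K x\<^sub>2 - K y)"
    using dual assms(11) by (simp add: dual_map_def)
  hence F2: "F x\<^sub>2 - F y = (\<epsilon> e\<^sub>1 * R x\<^sub>2) *\<^sub>R t"
    using nt r2 Dpos by (simp add: k2 \<epsilon> R_eq[OF assms(8) adj(2)] \<beta>_def power2_eq_square)
  have "F x\<^sub>2 - F x\<^sub>1 = (F x\<^sub>2 - F y) + (F y - F x\<^sub>1)" by simp
  also have "\<dots> = \<epsilon> e\<^sub>1 *\<^sub>R (R x\<^sub>2 + R x\<^sub>1) *\<^sub>R t"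
    unfolding F1 F2 by (simp add: algebra_simps)
  \<comment> \<open>Real linearity of \<open>stereo_tangent p\<close> moves the sum of the radii
    into its argument, where the stated formula has it.\<close>
  also have "(R x\<^sub>2 + R x\<^sub>1) *\<^sub>R t = stereo_tangent p ((R x\<^sub>2 + R x\<^sub>1) *\<^sub>R d)"
    by (simp add: t_def stereo_tangent_scaleR)
  also have "\<dots> = Re_vec
      ((of_real ((R x\<^sub>2 + R x\<^sub>1) / (1 + (cmod p)\<^sup>2)) *
          ((cnj (c x\<^sub>2) - cnj (c x\<^sub>1)) / of_real (cmod (c x\<^sub>2 - c x\<^sub>1)))) *s
        vector [1 - p\<^sup>2, \<i> * (1 + p\<^sup>2), 2 * p])"
    unfolding stereo_tangent_def d_def
    by (simp add: scaleR_conv_of_real field_simps)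
  finally show ?thesis
    using radius assms(7,8) adj \<epsilon> by blast
qed

end
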